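(* Let $n\geq 2$ and let $p$ be the largest prime with $p\leq n$. Then for every vector $v\in\mathbb{R}^n$ whose coordinates are pairwise distinct and do not sum to $0$, and every hyperplane $H\subset\mathbb{R}^n$ through the origin, \[ |H\cap S_nv|\leq \frac{n!}{p}. \] In particular, if $n\geq 3$ and $n=p$ or $n=p+1$, then \[ \max_{v,H}|H\cap S_nv|=\begin{cases}(n-1)!,& n\text{ odd},\\ n(n-2)!,& n\text{ even},\end{cases} \] where the maximum is over all $v\in\mathbb{R}^n$ with pairwise distinct coordinates not lying in the hyperplane $\sum_i x_i=0$ and all hyperplanes $H\subset\mathbb{R}^n$ through the origin.
   Context: The symmetric group $S_n$ acts on $\mathbb{R}^n$ by permuting coordinates; $S_nv$ denotes the orbit of $v$. *)

theory Defs
  imports "HOL-Analysis.Analysis"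
begin

definition perm_orbit :: "real^'n \<Rightarrow> (real^'n) set" where
  "perm_orbit v = {(\<chi> i. v $ \<sigma> i) | \<sigma>. \<sigma> permutes (UNIV :: 'n set)}"

definition admissible :: "real^'n \<Rightarrow> bool" where
  "admissible v \<longleftrightarrow> inj (\<lambda>i. v $ i) \<and> (\<Sum>i\<in>UNIV. v $ i) \<noteq> 0"

definition lin_hyperplane :: "(real^'n) set \<Rightarrow> bool" where
  "lin_hyperplane H \<longleftrightarrow> (\<exists>a. a \<noteq> 0 \<and> H = {x. a \<bullet> x = 0})"

end

theory Submission
  imports Defs "HOL-Combinatorics.Multiset_Permutations"
begin

text \<open>
  The sum of the coordinates is constant and nonzero on the orbit, so the normal vector \<open>a\<close> may be
  assumed non-constant. Freezing the values of the permuted vector outside a set of \<open>p\<close> positions on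
  which \<open>a\<close> is not constant reduces the bound to the case of \<open>p\<close> positions, at the price of an affine
  hyperplane \<open>a \<bullet> x = c\<close>.

  There, let \<open>m\<close> be the multiplicity of the largest entry of \<open>a\<close> and \<open>k = p - m\<close>. List the positions by
  increasing value of the vector, fix the order of the positions with largest entry and the order of
  the others, and record how many of the others precede each of the former. This is a multiset of size
  \<open>m\<close> in \<open>{0..k}\<close>, on which \<open>a \<bullet> x\<close> is strictly increasing in each element, and it remains to see that
  a strictly increasing function \<open>G\<close> takes every value \<open>c\<close> at most \<open>(p choose m) / p\<close> times.

  Multisets index the symmetric polynomials in \<open>m\<close> variables over the field with \<open>p\<close> elements of degree
  at most \<open>k\<close> in each variable, and such a polynomial is determined by its values at tuples of distinct
  arguments. The difference operator \<open>f(x + 1) - f(x)\<close> strictly lowers \<open>G\<close>, so it maps the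
  polynomials with \<open>G \<le> c\<close> to those with \<open>G < c\<close>, and its kernel has dimension at least the number of
  multisets with \<open>G = c\<close>. But a shift invariant polynomial is determined by its values at one
  \<open>m\<close>-subset of \<open>\<int>/p\<close> from each orbit of the shift, and there are \<open>(p choose m) / p\<close> orbits.
\<close>

section \<open>Polynomials modulo a prime\<close>

text \<open>Vectors over \<open>\<int>/q\<close> are modelled by integer vectors up to congruence; the usual dimension count is
  replaced by counting vectors.\<close>

lemma linear_system_mod:
  fixes Y :: "(('x \<Rightarrow> int) \<Rightarrow> int) set" and q :: nat
  assumes q: "q > 1" and X: "finite X" and Y: "finite Y" and less: "card Y < card X"
    and lin: "\<And>L \<phi> \<psi>. L \<in> Y \<Longrightarrow> L (\<lambda>x. \<phi> x - \<psi> x) = L \<phi> - L \<psi>"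
  obtains \<phi> where "\<And>x. x \<notin> X \<Longrightarrow> \<phi> x = 0" and "\<exists>x\<in>X. \<not> int q dvd \<phi> x"
    and "\<And>L. L \<in> Y \<Longrightarrow> int q dvd L \<phi>"
proof -
  let ?D = "X \<rightarrow>\<^sub>E {0..<int q}" and ?T = "Y \<rightarrow>\<^sub>E {0..<int q}"
  \<comment> \<open>Elements of \<open>?D\<close> are \<open>undefined\<close> off \<open>X\<close>;
    \<open>z\<close> makes them 0 there.\<close>
  define z where "z \<phi> x = (if x \<in> X then \<phi> x else 0 :: int)" for \<phi> x
  define F where "F \<phi> = (\<lambda>L\<in>Y. L (z \<phi>) mod int q)" for \<phi>
  \<comment> \<open>Pigeonhole: there are more vectors than value patterns, so two vectors collide,
    and their difference is the solution.\<close>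
  have "card ?T < card ?D"
    using q less X Y by (simp add: card_PiE)
  moreover have "F ` ?D \<subseteq> ?T"
    using q by (auto simp: F_def)
  moreover have "finite ?D" "finite ?T"
    using X Y by (auto intro!: finite_PiE)
  ultimately have "\<not> inj_on F ?D"
    by (metis card_inj_on_le not_less)
  then obtain \<phi> \<psi> where \<phi>: "\<phi> \<in> ?D" and \<psi>: "\<psi> \<in> ?D" and ne: "\<phi> \<noteq> \<psi>" and eq: "F \<phi> = F \<psi>"
    by (auto simp: inj_on_def)
  obtain x where x: "x \<in> X" "\<phi> x \<noteq> \<psi> x"
    using ne \<phi> \<psi> by (metis PiE_ext)
  show ?thesis
  proof (rule that[of "\<lambda>x. z \<phi> x - z \<psi> x"])
    have "\<phi> x \<in> {0..<int q}" "\<psi> x \<in> {0..<int q}"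
      using \<phi> \<psi> x by (auto simp: PiE_iff)
    then have "\<phi> x mod int q \<noteq> \<psi> x mod int q"
      using x by simp
    then have "\<not> int q dvd \<phi> x - \<psi> x"
      by (metis mod_eq_dvd_iff)
    then show "\<exists>x\<in>X. \<not> int q dvd z \<phi> x - z \<psi> x"
      using x by (auto simp: z_def)
  next
    fix L assume L: "L \<in> Y"
    then have "L (z \<phi>) mod int q = L (z \<psi>) mod int q"
      using fun_cong[OF eq, of L] by (simp add: F_def)
    then show "int q dvd L (\<lambda>x. z \<phi> x - z \<psi> x)"
      using lin[OF L] by (metis mod_eq_dvd_iff)
  qed (simp add: z_def)
qed

text \<open>Lagrange's bound on roots over a field, in terms of divisibility: after division by
  \<open>x - r\<close> the other points remain roots modulo \<open>p\<close>, because distinct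
  elements of \<open>{0..<int p}\<close> are incongruent.\<close>

lemma poly_roots_mod_prime:
  fixes q :: "int poly" and S :: "int set"
  assumes "prime p" and "S \<subseteq> {0..<int p}" and "degree q < card S"
    and "\<And>s. s \<in> S \<Longrightarrow> int p dvd poly q s"
  shows "int p dvd coeff q i"
  using assms(2-)
proof (induction "card S" arbitrary: S q i)
  case (Suc n)
  then obtain r where r: "r \<in> S"
    by fastforce
  have fin: "finite S"
    using Suc.hyps(2) by (metis card.infinite nat.distinct(1))
  define q' where "q' = synthetic_div q r"
  have q: "q = [:- r, 1:] * q' + [:poly q r:]"
    unfolding q'_def using synthetic_div_correct'[of r q] by simp
  have pr: "int p dvd poly q r"
    using Suc.prems r by blast
  have "int p dvd coeff q' i" for i
  proof (cases "degree q = 0")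
    case True
    then have "q' = 0"
      by (simp add: q'_def synthetic_div_eq_0_iff)
    then show ?thesis by simp
  next
    case False
    show ?thesis
    proof (rule Suc.hyps(1)[of "S - {r}"])
      show "n = card (S - {r})" "S - {r} \<subseteq> {0..<int p}"
        using Suc.hyps Suc.prems r fin by auto
      show "degree q' < card (S - {r})"
        using Suc.prems r fin False by (simp add: q'_def degree_synthetic_div)
    next
      fix s assume s: "s \<in> S - {r}"
      have "poly q s = (s - r) * poly q' s + poly q r"
        by (subst q) (simp add: algebra_simps)
      moreover have "int p dvd poly q s"
        using Suc.prems s by blast
      ultimately have "int p dvd (s - r) * poly q' s"
        using pr by (simp add: dvd_add_left_iff)
      moreover have "\<not> int p dvd s - r"
      proof -
        have "s \<in> {0..<int p}" "r \<in> {0..<int p}" "s \<noteq> r"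
          using s r Suc.prems(1) by auto
        then show ?thesis
          by (metis atLeastLessThan_iff mod_eq_dvd_iff mod_pos_pos_trivial)
      qed
      ultimately show "int p dvd poly q' s"
        using \<open>prime p\<close> by (simp add: prime_dvd_mult_iff)
    qed
  qed
  then show ?case
    by (subst q) (auto simp: coeff_pCons pr split: nat.split intro!: dvd_add dvd_diff dvd_mult)
qed auto

section \<open>Monomials in several variables and their shifts\<close>

text \<open>Exponent vectors of the monomials in \<open>m\<close> variables of degree at most
  \<open>k\<close> in each variable.\<close>

definition tuples :: "nat \<Rightarrow> nat \<Rightarrow> nat list set" where
  "tuples m k = {b. length b = m \<and> set b \<subseteq> {..k}}"

definition mono_val :: "int list \<Rightarrow> nat list \<Rightarrow> int" where
  "mono_val x b = (\<Prod>(z, j)\<leftarrow>zip x b. z ^ j)"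

text \<open>The coefficient of the monomial \<open>d\<close> in the monomial \<open>b\<close>
  evaluated at \<open>x + 1\<close>.\<close>

definition binom_prod :: "nat list \<Rightarrow> nat list \<Rightarrow> int" where
  "binom_prod b d = (\<Prod>(i, j)\<leftarrow>zip b d. int (i choose j))"

lemma mono_val_simps [simp]:
  "mono_val [] b = 1" "mono_val (z # x) (j # b) = z ^ j * mono_val x b"
  by (simp_all add: mono_val_def)

lemma binom_prod_simps [simp]:
  "binom_prod [] d = 1" "binom_prod (i # b) (j # d) = int (i choose j) * binom_prod b d"
  by (simp_all add: binom_prod_def)

lemma finite_tuples [simp]: "finite (tuples m k)"
  unfolding tuples_def using finite_lists_length_eq[of "{..k}" m] by (simp add: conj_commute)

lemma tuples_0 [simp]: "tuples 0 k = {[]}"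
  by (auto simp: tuples_def)

lemma sum_tuples_Suc:
  "(\<Sum>b\<in>tuples (Suc m) k. g b) = (\<Sum>j\<le>k. \<Sum>b\<in>tuples m k. g (j # b))"
proof -
  have "(\<Sum>j\<le>k. \<Sum>b\<in>tuples m k. g (j # b)) = (\<Sum>(j, b)\<in>{..k} \<times> tuples m k. g (j # b))"
    by (simp add: sum.cartesian_product)
  also have "\<dots> = (\<Sum>b\<in>tuples (Suc m) k. g b)"
    by (rule sum.reindex_bij_witness[of _ "\<lambda>b. (hd b, tl b)" "\<lambda>(j, b). j # b"])
      (auto simp: tuples_def length_Suc_conv)
  finally show ?thesis ..
qed

text \<open>Induction on the number of variables. When \<open>m\<close> of \<open>m + 1\<close>
  variables are frozen at distinct residues, the remaining one may still take
  \<open>p - m > k\<close> values, so every coefficient of the resulting polynomial in one variable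
  vanishes modulo \<open>p\<close>.\<close>

lemma monomials_independent_mod:
  assumes p: "prime p" and "m + k \<le> p"
    and "\<And>x. length x = m \<Longrightarrow> distinct x \<Longrightarrow> set x \<subseteq> {0..<int p} \<Longrightarrow>
           int p dvd (\<Sum>b\<in>tuples m k. c b * mono_val x b)"
    and "b \<in> tuples m k"
  shows "int p dvd c b"
  using assms(2-)
proof (induction m arbitrary: c b)
  case 0
  then show ?case
    using "0.prems"(2)[of "[]"] by simp
next
  case (Suc m)
  obtain j b' where b: "b = j # b'" and j: "j \<le> k" and b': "b' \<in> tuples m k"
    using Suc.prems(3) by (auto simp: tuples_def length_Suc_conv)
  have "int p dvd (\<Sum>b'\<in>tuples m k. c (j # b') * mono_val x b')"
    if x: "length x = m" "distinct x" "set x \<subseteq> {0..<int p}" for x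
  proof -
    define d where "d j = (\<Sum>b'\<in>tuples m k. c (j # b') * mono_val x b')" for j
    define q where "q = (\<Sum>j\<le>k. monom (d j) j)"
    have "card ({0..<int p} - set x) = p - m"
      using x by (simp add: card_Diff_subset distinct_card)
    moreover have "degree q \<le> k"
      unfolding q_def by (intro degree_sum_le) (auto intro: order.trans[OF degree_monom_le])
    ultimately have deg: "degree q < card ({0..<int p} - set x)"
      using Suc.prems(1) by simp
    have "int p dvd poly q s" if s: "s \<in> {0..<int p} - set x" for s
    proof -
      have "poly q s = (\<Sum>b\<in>tuples (Suc m) k. c b * mono_val (s # x) b)"
        unfolding sum_tuples_Suc
        by (simp add: q_def d_def poly_sum poly_monom sum_distrib_right sum_distrib_left
            algebra_simps)
      also have "int p dvd \<dots>"
        using x s by (intro Suc.prems(2)) auto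
      finally show ?thesis .
    qed
    from poly_roots_mod_prime[OF p _ deg this] have "int p dvd coeff q j"
      by auto
    moreover have "coeff q j = d j"
      using j by (simp add: q_def coeff_sum)
    ultimately show ?thesis
      by (simp add: d_def)
  qed
  then have "int p dvd c (j # b')"
    using Suc.prems(1) b' by (intro Suc.IH[of "\<lambda>b'. c (j # b')"]) auto
  then show ?case
    by (simp add: b)
qed

lemma mono_val_shift:
  assumes "length x = m" "b \<in> tuples m k"
  shows "mono_val (map (\<lambda>z. z + 1) x) b = (\<Sum>d\<in>tuples m k. binom_prod b d * mono_val x d)"
  using assms
proof (induction m arbitrary: x b)
  case (Suc m)
  obtain z x' where x: "x = z # x'" "length x' = m"
    using Suc.prems by (auto simp: length_Suc_conv)
  obtain i b' where b: "b = i # b'" "i \<le> k" "b' \<in> tuples m k"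
    using Suc.prems by (auto simp: tuples_def length_Suc_conv)
  have "(z + 1) ^ i = (\<Sum>j\<le>i. int (i choose j) * z ^ j)"
    by (simp add: binomial_ring)
  also have "\<dots> = (\<Sum>j\<le>k. int (i choose j) * z ^ j)"
    using b by (intro sum.mono_neutral_left) auto
  finally have "(z + 1) ^ i = (\<Sum>j\<le>k. int (i choose j) * z ^ j)" .
  then show ?case
    by (simp add: x b sum_tuples_Suc Suc.IH sum_product mult_ac)
qed simp

lemma binom_prod_self [simp]: "binom_prod b b = 1"
  by (induction b) auto

lemma binom_prod_nonzero_imp_le:
  assumes "length b = length d" "binom_prod b d \<noteq> 0"
  shows "list_all2 (\<le>) d b"
  using assms
  by (induction b d rule: list_induct2) (auto simp: not_le[symmetric])

lemma prod_list_zip_permute: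
  fixes g :: "_ \<Rightarrow> int"
  assumes "\<pi> permutes {..<length x}" "length b = length x"
  shows "prod_list (map g (zip (permute_list \<pi> x) (permute_list \<pi> b))) = prod_list (map g (zip x b))"
proof -
  have "zip (permute_list \<pi> x) (permute_list \<pi> b) = permute_list \<pi> (zip x b)"
    using assms by (simp add: permute_list_zip)
  moreover have "mset (permute_list \<pi> (zip x b)) = mset (zip x b)"
    using assms by simp
  ultimately show ?thesis
    by (metis mset_map prod_mset_prod_list)
qed

text \<open>A permutation carrying \<open>x\<close> to \<open>y\<close> reindexes the sum. The
  kernel \<open>h\<close> is left general because this serves both for the values of a symmetric
  polynomial and for the coefficients of its difference.\<close>

lemma sum_tuples_symmetric:
  fixes \<phi> :: "nat multiset \<Rightarrow> int"
  assumes sym: "\<And>\<pi> x b. \<pi> permutes {..<length x} \<Longrightarrow> length x = m \<Longrightarrow> length b = m \<Longrightarrow>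
      h (permute_list \<pi> x) (permute_list \<pi> b) = h x b"
    and eq: "mset x = mset y" and len: "length x = m"
  shows "(\<Sum>b\<in>tuples m k. \<phi> (mset b) * h x b) = (\<Sum>b\<in>tuples m k. \<phi> (mset b) * h y b)"
proof -
  obtain \<pi> where \<pi>: "\<pi> permutes {..<length x}" "permute_list \<pi> x = y"
    using mset_eq_permutation[of y x] eq by metis
  have inv: "inv \<pi> permutes {..<length x}"
    using \<pi>(1) by (rule permutes_inv)
  show ?thesis
  proof (rule sum.reindex_bij_witness[of _ "permute_list (inv \<pi>)" "permute_list \<pi>"])
    fix b assume b: "b \<in> tuples m k"
    then have lb: "length b = length x"
      using len by (simp add: tuples_def)
    show "permute_list (inv \<pi>) (permute_list \<pi> b) = b" "permute_list \<pi> (permute_list (inv \<pi>) b) = b"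
      using lb \<pi>(1) inv permutes_inv_o[OF \<pi>(1)]
      by (simp_all flip: permute_list_compose)
    show "permute_list \<pi> b \<in> tuples m k" "permute_list (inv \<pi>) b \<in> tuples m k"
      using b lb \<pi>(1) inv by (simp_all add: tuples_def)
    show "\<phi> (mset (permute_list \<pi> b)) * h y (permute_list \<pi> b) = \<phi> (mset b) * h x b"
      using sym[OF \<pi>(1) len, of b] lb len \<pi> by simp
  qed
qed

section \<open>Subsets modulo a prime under translation\<close>

definition cyc_shift :: "nat \<Rightarrow> int \<Rightarrow> int set \<Rightarrow> int set" where
  "cyc_shift p t A = (\<lambda>z. (z + t) mod int p) ` A"

lemma inj_on_add_mod: "inj_on (\<lambda>z. (z + t) mod int p) {0..<int p}"
proof (rule inj_onI)
  fix z w assume zw: "z \<in> {0..<int p}" "w \<in> {0..<int p}" and "(z + t) mod int p = (w + t) mod int p"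
  then have "z mod int p = w mod int p"
    by (metis add_diff_cancel_right mod_eq_dvd_iff)
  with zw show "z = w"
    by simp
qed

lemma cyc_shift_props:
  assumes A: "A \<subseteq> {0..<int p}" and p: "p > 0"
  shows "cyc_shift p t A \<subseteq> {0..<int p}" and "card (cyc_shift p t A) = card A"
    and "int p dvd \<Sum>(cyc_shift p t A) - (\<Sum>A + int (card A) * t)"
    and "cyc_shift p (- t) (cyc_shift p t A) = A"
proof -
  have inj: "inj_on (\<lambda>z. (z + t) mod int p) A"
    using inj_on_add_mod A by (rule inj_on_subset)
  show "cyc_shift p t A \<subseteq> {0..<int p}"
    using p by (auto simp: cyc_shift_def)
  show "card (cyc_shift p t A) = card A"
    unfolding cyc_shift_def using inj by (rule card_image)
  have "\<Sum>(cyc_shift p t A) - (\<Sum>A + int (card A) * t) = (\<Sum>z\<in>A. (z + t) mod int p - (z + t))"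
    unfolding cyc_shift_def
    by (simp add: sum.reindex[OF inj] sum_subtractf sum.distrib)
  also have "int p dvd \<dots>"
    by (intro dvd_sum) (metis mod_eq_dvd_iff mod_mod_trivial)
  finally show "int p dvd \<Sum>(cyc_shift p t A) - (\<Sum>A + int (card A) * t)" .
  have "((z + t) mod int p - t) mod int p = z" if "z \<in> A" for z
  proof -
    have "z \<in> {0..<int p}"
      using that A by blast
    then show ?thesis
      by (simp add: mod_diff_left_eq)
  qed
  then show "cyc_shift p (- t) (cyc_shift p t A) = A"
    by (force simp: cyc_shift_def image_image)
qed

text \<open>Translation by \<open>t\<close> changes the sum of an \<open>m\<close>-subset by \<open>m t\<close>, so every orbit contains exactly one
  zero-sum subset when \<open>0 < m < p\<close>.\<close>

definition zero_sum_subsets :: "nat \<Rightarrow> nat \<Rightarrow> int set set" where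
  "zero_sum_subsets p m = {A. A \<subseteq> {0..<int p} \<and> card A = m \<and> int p dvd \<Sum>A}"

text \<open>Inverting \<open>m\<close> modulo \<open>p\<close> by Bezout gives the translation that
  changes the sum of an \<open>m\<close>-subset by the residue \<open>r\<close>.\<close>

lemma shift_to_residue:
  assumes p: "prime p" and m: "0 < m" "m < p"
  obtains t where "int p dvd int m * t - r"
proof -
  have "coprime (int m) (int p)"
    using m p by (metis coprime_commute coprime_int_iff nat_dvd_not_less prime_imp_coprime_nat)
  then obtain u v where "u * int m + v * int p = 1"
    using bezout_int[of "int m" "int p"] by auto
  then have "int m * (u * r) - r = int p * (- v * r)"
    by (simp add: algebra_simps) (metis distrib_left mult.right_neutral)
  then show ?thesis
    using that[of "u * r"] by simp
qed

text \<open>Translation embeds the zero-sum subsets into the \<open>m\<close>-subsets of any given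
  sum modulo \<open>p\<close>, and these \<open>p\<close> classes are disjoint.\<close>

lemma card_zero_sum_subsets:
  assumes p: "prime p" and m: "0 < m" "m < p"
  shows "card (zero_sum_subsets p m) * p \<le> p choose m"
proof -
  have p0: "p > 0" using m by simp
  define T where "T = {A. A \<subseteq> {0..<int p} \<and> card A = m}"
  define S where "S r = {A \<in> T. \<Sum>A mod int p = r}" for r
  have T: "finite T" "card T = p choose m"
    unfolding T_def by (simp_all add: n_subsets)
  have "card (zero_sum_subsets p m) \<le> card (S r)" if r: "r \<in> {0..<int p}" for r
  proof -
    obtain t where t: "int p dvd int m * t - r"
      using shift_to_residue[OF p m] .
    have "inj_on (cyc_shift p t) (zero_sum_subsets p m)"
      by (rule inj_on_inverseI[of _ "cyc_shift p (- t)"])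
        (use p0 in \<open>auto simp: zero_sum_subsets_def intro!: cyc_shift_props(4)\<close>)
    moreover have "cyc_shift p t ` zero_sum_subsets p m \<subseteq> S r"
    proof clarify
      fix A assume A: "A \<in> zero_sum_subsets p m"
      note * = cyc_shift_props[of A p t]
      have "int p dvd \<Sum>(cyc_shift p t A) - (\<Sum>A + int m * t) + (\<Sum>A + (int m * t - r))"
        using A * p0 t by (intro dvd_add) (auto simp: zero_sum_subsets_def)
      then have "int p dvd \<Sum>(cyc_shift p t A) - r"
        by (simp add: algebra_simps)
      then have "\<Sum>(cyc_shift p t A) mod int p = r mod int p"
        by (simp add: mod_eq_dvd_iff)
      then show "cyc_shift p t A \<in> S r"
        using A * p0 r by (auto simp: S_def T_def zero_sum_subsets_def)
    qed
    ultimately show ?thesis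
      using T(1) by (intro card_inj_on_le[of "cyc_shift p t"]) (auto simp: S_def)
  qed
  then have "(\<Sum>r\<in>{0..<int p}. card (zero_sum_subsets p m)) \<le> (\<Sum>r\<in>{0..<int p}. card (S r))"
    by (rule sum_mono)
  also have "\<dots> = card (\<Union>r\<in>{0..<int p}. S r)"
    using T(1) by (subst card_UN_disjoint) (auto simp: S_def)
  also have "\<dots> \<le> card T"
    using T(1) by (intro card_mono) (auto simp: S_def)
  finally show ?thesis
    using T by (simp add: mult.commute)
qed

section \<open>Level sets of increasing functions on multisets\<close>

text \<open>Raise the entries of \<open>d\<close> to those of \<open>b\<close> one at a time, each
  in unit steps; every unit step increases \<open>G\<close>.\<close>

lemma multiset_order_strict_mono:
  fixes G :: "nat multiset \<Rightarrow> real"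
  assumes step: "\<And>N j. size N + 1 = m \<Longrightarrow> set_mset N \<subseteq> {..k} \<Longrightarrow> j < k \<Longrightarrow>
      G (add_mset j N) < G (add_mset (Suc j) N)"
    and le: "list_all2 (\<le>) d b" and b: "b \<in> tuples m k" and ne: "d \<noteq> b"
  shows "G (mset d) < G (mset b)"
proof -
  have one: "G (add_mset i N) < G (add_mset j N)"
    if "i < j" "j \<le> k" "size N + 1 = m" "set_mset N \<subseteq> {..k}" for i j N
    using that
  proof (induction j)
    case (Suc j)
    then show ?case
      using step[of N j] by (cases "i = j") (auto simp: less_Suc_eq intro: less_trans)
  qed simp
  \<comment> \<open>\<open>N\<close> collects the entries already set aside by the induction. The
    weak inequality is carried along because some entries may agree.\<close>
  have "(G (mset d + N) \<le> G (mset b + N)) \<and> (d \<noteq> b \<longrightarrow> G (mset d + N) < G (mset b + N))"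
    if "size N + length b = m" "set_mset N \<subseteq> {..k}" "set b \<subseteq> {..k}" for N
    using le that
  proof (induction arbitrary: N rule: list_all2_induct)
    case (Cons i d j b)
    have len: "length d = length b"
      using Cons.hyps(2) by (rule list_all2_lengthD)
    have 1: "G (mset d + add_mset i N) \<le> G (mset b + add_mset i N)"
      "d \<noteq> b \<longrightarrow> G (mset d + add_mset i N) < G (mset b + add_mset i N)"
      using Cons.IH[of "add_mset i N"] Cons.prems Cons.hyps(1) by auto
    have 2: "G (add_mset i (mset b + N)) \<le> G (add_mset j (mset b + N))
        \<and> (i \<noteq> j \<longrightarrow> G (add_mset i (mset b + N)) < G (add_mset j (mset b + N)))"
      using one[of i j "mset b + N"] Cons.prems Cons.hyps(1) by (cases "i = j") auto
    show ?case
      using 1 2 by (auto simp: ac_simps)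
  qed auto
  from this[of "{#}"] show ?thesis
    using b ne by (simp add: tuples_def)
qed

text \<open>Equivalently, partitions inside an \<open>m\<close> by \<open>k\<close> box; each
  indexes a monomial symmetric polynomial.\<close>

definition boxed_multisets :: "nat \<Rightarrow> nat \<Rightarrow> nat multiset set" where
  "boxed_multisets m k = {M. size M = m \<and> set_mset M \<subseteq> {..k}}"

lemma mset_in_boxed [simp]: "mset b \<in> boxed_multisets m k \<longleftrightarrow> b \<in> tuples m k"
  by (simp add: boxed_multisets_def tuples_def)

lemma sorted_list_in_tuples [simp]:
  "sorted_list_of_multiset M \<in> tuples m k \<longleftrightarrow> M \<in> boxed_multisets m k"
  by (metis mset_in_boxed mset_sorted_list_of_multiset)

lemma finite_boxed_multisets [simp]: "finite (boxed_multisets m k)"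
proof (rule finite_subset)
  show "boxed_multisets m k \<subseteq> mset ` tuples m k"
    by (metis imageI mset_sorted_list_of_multiset sorted_list_in_tuples subsetI)
qed simp

lemma mono_val_cong_mod:
  assumes "list_all2 (\<lambda>z w. n dvd z - w) x y"
  shows "n dvd mono_val x b - mono_val y b"
  using assms
proof (induction arbitrary: b rule: list_all2_induct)
  case (Cons z x w y)
  show ?case
  proof (cases b)
    case (Cons j b')
    have "mono_val (z # x) b - mono_val (w # y) b
        = z ^ j * (mono_val x b' - mono_val y b') + (z ^ j - w ^ j) * mono_val y b'"
      by (simp add: Cons algebra_simps)
    moreover have "n dvd z ^ j - w ^ j"
      using Cons.hyps(1) by (metis mod_eq_dvd_iff power_mod)
    ultimately show ?thesis
      using Cons.IH by simp
  qed (simp add: mono_val_def)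
qed simp

text \<open>Some translate of the entries of \<open>x\<close> has sum zero modulo \<open>p\<close>,
  and translating, reducing modulo \<open>p\<close> and sorting all preserve \<open>P\<close> modulo
  \<open>p\<close>.\<close>

lemma shift_invariant_vanishing_mod:
  fixes P :: "int list \<Rightarrow> int"
  assumes p: "prime p" and m: "0 < m" "m < p"
    and shift: "\<And>x. length x = m \<Longrightarrow> int p dvd P (map (\<lambda>z. z + 1) x) - P x"
    and cong: "\<And>x y. length x = m \<Longrightarrow> list_all2 (\<lambda>z w. int p dvd z - w) x y \<Longrightarrow> int p dvd P x - P y"
    and sym: "\<And>x y. length x = m \<Longrightarrow> mset x = mset y \<Longrightarrow> P x = P y"
    and zero: "\<And>A. A \<in> zero_sum_subsets p m \<Longrightarrow> int p dvd P (sorted_list_of_set A)"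
    and x: "length x = m" "distinct x" "set x \<subseteq> {0..<int p}"
  shows "int p dvd P x"
proof -
  have p0: "p > 0" using m by simp
  have iter: "int p dvd P (map (\<lambda>z. z + int t) x) - P x" for t
  proof (induction t)
    case (Suc t)
    have "int p dvd P (map (\<lambda>z. z + 1) (map (\<lambda>z. z + int t) x)) - P (map (\<lambda>z. z + int t) x)"
      using x by (intro shift) simp
    then have "int p dvd (P (map (\<lambda>z. z + int (Suc t)) x) - P (map (\<lambda>z. z + int t) x))
        + (P (map (\<lambda>z. z + int t) x) - P x)"
      using Suc by (intro dvd_add) (simp_all add: o_def add_ac)
    then show ?case by simp
  qed simp
  obtain t where t: "int p dvd int m * t - (- \<Sum>(set x))"
    using shift_to_residue[OF p m] .
  \<comment> \<open>\<open>iter\<close> covers natural shifts only, so the possibly negative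
    \<open>t\<close> is replaced by its residue.\<close>
  define s where "s = nat (t mod int p)"
  have "int p dvd int s - t"
    using p0 by (simp add: s_def flip: mod_eq_dvd_iff)
  then have "int p dvd int m * (int s - t) + (int m * t - (- \<Sum>(set x)))"
    using t by (intro dvd_add) auto
  then have s: "int p dvd \<Sum>(set x) + int m * int s"
    by (simp add: algebra_simps)
  define y where "y = map (\<lambda>z. (z + int s) mod int p) x"
  have card: "card (set x) = m"
    using x distinct_card by auto
  have sety: "set y = cyc_shift p (int s) (set x)"
    by (auto simp: y_def cyc_shift_def)
  note * = cyc_shift_props[OF x(3) p0, of "int s"]
  have "int p dvd (\<Sum>(set y) - (\<Sum>(set x) + int (card (set x)) * int s)) + (\<Sum>(set x) + int m * int s)"
    using *(3) s unfolding sety by (rule dvd_add)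
  then have "set y \<in> zero_sum_subsets p m"
    using * by (simp add: sety zero_sum_subsets_def card)
  moreover have "distinct y"
    using * sety card by (intro card_distinct) (simp add: y_def x)
  then have "mset (sorted_list_of_set (set y)) = mset y"
    by (simp flip: set_eq_iff_mset_eq_distinct)
  then have "P y = P (sorted_list_of_set (set y))"
    by (intro sym) (simp_all add: y_def x)
  ultimately have "int p dvd P y"
    using zero by simp
  moreover have "int p dvd P (map (\<lambda>z. z + int s) x) - P y"
    by (intro cong)
      (auto simp: y_def x list_all2_map1 list_all2_map2 list_all2_same simp flip: mod_eq_dvd_iff)
  ultimately show ?thesis
    using iter[of s] by (smt (verit) dvd_diff_commute dvd_add_right_iff)
qed

text \<open>The dimension count, by contradiction. If the level set outnumbered the zero-sum
  subsets, some \<open>\<phi>\<close> supported on \<open>G \<le> c\<close> and not zero modulo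
  \<open>p\<close> would satisfy all conditions in \<open>Y\<close>. Its polynomial would be shift
  invariant and vanish at the orbit representatives, hence at all tuples of distinct residues,
  against the independence of monomials.\<close>

lemma level_set_bound:
  fixes G :: "nat multiset \<Rightarrow> real"
  assumes p: "prime p" and mk: "m + k = p" and m: "0 < m" and k: "0 < k"
    and step: "\<And>N j. size N + 1 = m \<Longrightarrow> set_mset N \<subseteq> {..k} \<Longrightarrow> j < k \<Longrightarrow>
      G (add_mset j N) < G (add_mset (Suc j) N)"
  shows "card {M \<in> boxed_multisets m k. G M = c} * p \<le> p choose m"
proof -
  let ?R = "zero_sum_subsets p m"
  let ?Z = "{M \<in> boxed_multisets m k. G M = c}"
  define X where "X = {M \<in> boxed_multisets m k. G M \<le> c}"
  define X' where "X' = {M \<in> boxed_multisets m k. G M < c}"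
  define P where "P \<phi> x = (\<Sum>b\<in>tuples m k. \<phi> (mset b) * mono_val x b)"
    for x and \<phi> :: "nat multiset \<Rightarrow> int"
  \<comment> \<open>The diagonal coefficient 1 of \<open>binom_prod\<close> reproduces
    \<open>P \<phi> x\<close>; dropping it leaves the difference.\<close>
  define binom where "binom d b = (if b = d then 0 else binom_prod b d)" for d b
  \<comment> \<open>\<open>Q \<phi> d\<close> is the coefficient of the monomial \<open>d\<close> in \<open>P \<phi> (x + 1) - P \<phi> x\<close>.\<close>
  define Q where "Q \<phi> d = (\<Sum>b\<in>tuples m k. \<phi> (mset b) * binom d b)"
    for d and \<phi> :: "nat multiset \<Rightarrow> int"
  \<comment> \<open>At most \<open>card X' + card ?R\<close> conditions, against
    \<open>card X' + card ?Z\<close> unknowns.\<close>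
  define Y where "Y = (\<lambda>M \<phi>. Q \<phi> (sorted_list_of_multiset M)) ` X' \<union>
      (\<lambda>A \<phi>. P \<phi> (sorted_list_of_set A)) ` ?R"
  have finR: "finite ?R"
    by (rule finite_subset[of _ "Pow {0..<int p}"]) (auto simp: zero_sum_subsets_def)
  have "card ?Z \<le> card ?R"
  proof (rule ccontr)
    assume "\<not> card ?Z \<le> card ?R"
    moreover have "card X = card X' + card ?Z"
      by (subst card_Un_disjoint[symmetric]) (auto simp: X_def X'_def intro!: arg_cong[of _ _ card])
    moreover have "card Y \<le> card X' + card ?R"
      unfolding Y_def using finR
      by (intro order.trans[OF card_Un_le] add_mono card_image_le) (auto simp: X'_def)
    ultimately have less: "card Y < card X"
      by simp
    obtain \<phi> where supp: "\<And>M. M \<notin> X \<Longrightarrow> \<phi> M = 0" and ne: "\<exists>M\<in>X. \<not> int p dvd \<phi> M"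
      and Y0: "\<And>L. L \<in> Y \<Longrightarrow> int p dvd L \<phi>"
    proof (rule linear_system_mod[of p X Y])
      show "p > 1" using p by (rule prime_gt_1_nat)
      show "finite X" by (simp add: X_def)
      show "finite Y" using finR by (simp add: Y_def X'_def)
      show "card Y < card X" by (rule less)
      show "L (\<lambda>x. \<phi> x - \<psi> x) = L \<phi> - L \<psi>" if "L \<in> Y" for L \<phi> \<psi>
        using that by (auto simp: Y_def P_def Q_def algebra_simps sum_subtractf)
    qed blast
    have Q0: "int p dvd Q \<phi> d" if d: "d \<in> tuples m k" for d
    proof (cases "G (mset d) < c")
      case True
      \<comment> \<open>\<open>Y\<close> has conditions for sorted exponent lists only; symmetry
        transfers them to \<open>d\<close>.\<close>
      have "Q \<phi> d = Q \<phi> (sorted_list_of_multiset (mset d))"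
        unfolding Q_def
      proof (rule sum_tuples_symmetric)
        fix \<pi> and d b :: "nat list"
        assume "\<pi> permutes {..<length d}" "length d = m" "length b = m"
        then show "binom (permute_list \<pi> d) (permute_list \<pi> b) = binom d b"
          using prod_list_zip_permute[of \<pi> b d] list_all2_permute_list_iff[of \<pi> b "(=)" d]
          by (simp add: binom_def binom_prod_def list_all2_eq[symmetric])
      qed (use d in \<open>auto simp: tuples_def\<close>)
      moreover have "(\<lambda>\<phi>. Q \<phi> (sorted_list_of_multiset (mset d))) \<in> Y"
        unfolding Y_def using True d by (intro UnI1 image_eqI[of _ _ "mset d"]) (auto simp: X'_def)
      ultimately show ?thesis
        using Y0 by fastforce
    next
      case False
      \<comment> \<open>Here no condition is imposed: any contributing \<open>b\<close> would
        dominate \<open>d\<close> entrywise, so \<open>G (mset b) > G (mset d) \<ge> c\<close>,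
        which lies outside the support of \<open>\<phi>\<close>.\<close>
      have "\<phi> (mset b) * binom d b = 0" if b: "b \<in> tuples m k" for b
      proof (rule ccontr)
        assume "\<phi> (mset b) * binom d b \<noteq> 0"
        then have "b \<noteq> d" "binom_prod b d \<noteq> 0" "mset b \<in> X"
          using supp by (auto simp: binom_def split: if_splits)
        moreover from this have "list_all2 (\<le>) d b"
          using b d by (intro binom_prod_nonzero_imp_le) (auto simp: tuples_def)
        ultimately have "G (mset d) < G (mset b)"
          using b by (intro multiset_order_strict_mono[of m k G d b] step) auto
        with False \<open>mset b \<in> X\<close> show False
          by (simp add: X_def)
      qed
      then have "Q \<phi> d = 0"
        unfolding Q_def by (intro sum.neutral) blast
      then show ?thesis
        by simp
    qed
    have "int p dvd P \<phi> x" if x: "length x = m" "distinct x" "set x \<subseteq> {0..<int p}" for x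
    proof (rule shift_invariant_vanishing_mod[OF p m])
      show "m < p" using mk k by simp
    next
      fix x :: "int list" assume x: "length x = m"
      have "P \<phi> (map (\<lambda>z. z + 1) x)
          = (\<Sum>b\<in>tuples m k. \<Sum>d\<in>tuples m k. \<phi> (mset b) * binom_prod b d * mono_val x d)"
        unfolding P_def by (intro sum.cong) (simp_all add: mono_val_shift[OF x] sum_distrib_left mult_ac)
      also have "\<dots> = (\<Sum>b\<in>tuples m k. \<phi> (mset b) * mono_val x b +
          (\<Sum>d\<in>tuples m k. \<phi> (mset b) * binom d b * mono_val x d))"
      proof (intro sum.cong refl)
        fix b assume b: "b \<in> tuples m k"
        have "(\<Sum>d\<in>tuples m k. \<phi> (mset b) * binom_prod b d * mono_val x d)
           = (\<Sum>d\<in>tuples m k. (if d = b then \<phi> (mset b) * mono_val x d else 0)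
               + \<phi> (mset b) * binom d b * mono_val x d)"
          by (intro sum.cong) (auto simp: binom_def)
        then show "(\<Sum>d\<in>tuples m k. \<phi> (mset b) * binom_prod b d * mono_val x d) = \<phi> (mset b) * mono_val x b +
          (\<Sum>d\<in>tuples m k. \<phi> (mset b) * binom d b * mono_val x d)"
          using b by (simp add: sum.distrib)
      qed
      also have "\<dots> = P \<phi> x + (\<Sum>b\<in>tuples m k. \<Sum>d\<in>tuples m k. \<phi> (mset b) * binom d b * mono_val x d)"
        by (simp add: P_def sum.distrib)
      also have "(\<Sum>b\<in>tuples m k. \<Sum>d\<in>tuples m k. \<phi> (mset b) * binom d b * mono_val x d)
          = (\<Sum>d\<in>tuples m k. Q \<phi> d * mono_val x d)"
        by (subst sum.swap) (simp add: Q_def sum_distrib_right)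
      finally have "P \<phi> (map (\<lambda>z. z + 1) x) - P \<phi> x = (\<Sum>d\<in>tuples m k. Q \<phi> d * mono_val x d)"
        by simp
      also have "int p dvd \<dots>"
        using Q0 by (intro dvd_sum dvd_mult2)
      finally show "int p dvd P \<phi> (map (\<lambda>z. z + 1) x) - P \<phi> x" .
    next
      fix x y :: "int list" assume "list_all2 (\<lambda>z w. int p dvd z - w) x y"
      then show "int p dvd P \<phi> x - P \<phi> y"
        unfolding P_def sum_subtractf[symmetric] right_diff_distrib[symmetric]
        by (intro dvd_sum dvd_mult mono_val_cong_mod)
    next
      fix x y :: "int list" assume "length x = m" "mset x = mset y"
      then show "P \<phi> x = P \<phi> y"
        unfolding P_def by (intro sum_tuples_symmetric) (auto simp: mono_val_def prod_list_zip_permute)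
    next
      fix A assume "A \<in> zero_sum_subsets p m"
      then have "(\<lambda>\<phi>. P \<phi> (sorted_list_of_set A)) \<in> Y"
        by (auto simp: Y_def)
      then show "int p dvd P \<phi> (sorted_list_of_set A)"
        using Y0 by fastforce
    qed (use x in auto)
    then have "int p dvd \<phi> (mset b)" if "b \<in> tuples m k" for b
      using monomials_independent_mod[OF p, of m k "\<lambda>b. \<phi> (mset b)" b] mk that by (simp add: P_def)
    then have "int p dvd \<phi> M" if "M \<in> X" for M
      using that by (metis (no_types, lifting) X_def mem_Collect_eq mset_sorted_list_of_multiset sorted_list_in_tuples)
    with ne show False by blast
  qed
  then have "card ?Z * p \<le> card ?R * p"
    by simp
  also have "\<dots> \<le> p choose m"
    using mk k by (intro card_zero_sum_subsets[OF p m]) simp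
  finally show ?thesis .
qed

section \<open>Interleavings of two lists\<close>

text \<open>For each entry satisfying \<open>P\<close>, the number of earlier entries that fail
  it.\<close>

fun gaps :: "('a \<Rightarrow> bool) \<Rightarrow> 'a list \<Rightarrow> nat multiset" where
  "gaps P [] = {#}"
| "gaps P (y # L) = (if P y then add_mset 0 (gaps P L) else image_mset Suc (gaps P L))"

text \<open>\<open>t\<close> is the position of the head, which lets the sum split along an
  append.\<close>

fun wsum :: "('a \<Rightarrow> real) \<Rightarrow> (nat \<Rightarrow> real) \<Rightarrow> nat \<Rightarrow> 'a list \<Rightarrow> real" where
  "wsum a v t [] = 0"
| "wsum a v t (y # L) = a y * v t + wsum a v (Suc t) L"

lemma gaps_append:
  "gaps P (B @ C) = gaps P B + image_mset (\<lambda>i. length (filter (Not \<circ> P) B) + i) (gaps P C)"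
  by (induction B) (simp_all add: multiset.map_comp o_def)

lemma gaps_in_boxed:
  "gaps P L \<in> boxed_multisets (length (filter P L)) (length (filter (Not \<circ> P) L))"
  by (induction L) (auto simp: boxed_multisets_def)

text \<open>The list is decoded from the front: 0 occurs among the gaps exactly when the first entry
  satisfies \<open>P\<close>.\<close>

lemma gaps_inj:
  assumes "filter P L = filter P L'" "filter (Not \<circ> P) L = filter (Not \<circ> P) L'" "gaps P L = gaps P L'"
  shows "L = L'"
  using assms
proof (induction L arbitrary: L')
  case Nil
  then show ?case
    by (cases L') (auto split: if_splits)
next
  case (Cons y L)
  have zero: "0 \<in># gaps P (z # K) \<longleftrightarrow> P z" for z K
    by auto
  obtain y' K where L': "L' = y' # K"
    using Cons.prems by (cases L') (auto split: if_splits)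
  have "P y \<longleftrightarrow> P y'"
    using Cons.prems(3) zero unfolding L' by metis
  then show ?case
    using Cons.prems Cons.IH[of K]
    by (auto simp: L' split: if_splits dest: multiset.inj_map_strong[rotated])
qed

text \<open>Greedy decoding: the next entry comes from \<open>L1\<close> if 0 occurs in
  \<open>M\<close>; otherwise it comes from \<open>L2\<close> and all gaps drop by one.\<close>

lemma gaps_surj:
  assumes "\<forall>y\<in>set L1. P y" "\<forall>z\<in>set L2. \<not> P z" "M \<in> boxed_multisets (length L1) (length L2)"
  shows "\<exists>L. filter P L = L1 \<and> filter (Not \<circ> P) L = L2 \<and> gaps P L = M"
  using assms
proof (induction "length L1 + length L2" arbitrary: L1 L2 M)
  case 0
  then show ?case
    by (intro exI[of _ "[]"]) (auto simp: boxed_multisets_def)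
next
  case (Suc n)
  show ?case
  proof (cases "0 \<in># M")
    case True
    then obtain M' where M: "M = add_mset 0 M'"
      by (metis insert_DiffM)
    then obtain y L1' where L1: "L1 = y # L1'"
      using Suc.prems by (cases L1) (auto simp: boxed_multisets_def)
    obtain L where "filter P L = L1'" "filter (Not \<circ> P) L = L2" "gaps P L = M'"
      using Suc.hyps(1)[of L1' L2 M'] Suc.hyps(2) Suc.prems by (auto simp: L1 M boxed_multisets_def)
    then show ?thesis
      using Suc.prems by (intro exI[of _ "y # L"]) (auto simp: L1 M)
  next
    case False
    have M: "M = image_mset Suc (image_mset (\<lambda>i. i - 1) M)"
      using False by (auto simp: multiset.map_comp o_def intro!: multiset.map_ident_strong[symmetric])
        (metis Suc_pred neq0_conv)
    show ?thesis
    proof (cases L2)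
      case Nil
      have "M = {#}"
      proof (rule ccontr)
        assume "M \<noteq> {#}"
        then obtain i where "i \<in># M" by blast
        with False Suc.prems(3) Nil show False
          by (auto simp: boxed_multisets_def)
      qed
      with Suc Nil show ?thesis
        by (auto simp: boxed_multisets_def)
    next
      case (Cons z L2')
      have "image_mset (\<lambda>i. i - 1) M \<in> boxed_multisets (length L1) (length L2')"
        using Suc.prems Cons by (auto simp: boxed_multisets_def)
      then obtain L where "filter P L = L1" "filter (Not \<circ> P) L = L2'"
        "gaps P L = image_mset (\<lambda>i. i - 1) M"
        using Suc.hyps(1)[of L1 L2'] Suc.hyps(2) Suc.prems Cons by auto
      then show ?thesis
        using Suc.prems Cons M by (intro exI[of _ "z # L"]) auto
    qed
  qed
qed

text \<open>The last \<open>P\<close>-entry with gap \<open>j\<close> is directly followed by an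
  entry failing \<open>P\<close>, since such an entry is still to come. Exchanging the two will
  raise one gap from \<open>j\<close> to \<open>j + 1\<close>.\<close>

lemma gaps_split:
  assumes "j \<in># gaps P L" "j < length (filter (Not \<circ> P) L)"
  obtains B y z C where "L = B @ y # z # C" "P y" "\<not> P z" "length (filter (Not \<circ> P) B) = j"
  using assms
proof (induction L arbitrary: j thesis)
  case (Cons y L)
  show ?case
  proof (cases "P y")
    case True
    show ?thesis
    proof (cases "j \<in># gaps P L")
      case T: True
      show ?thesis
        by (rule Cons.IH[OF _ T]) (use Cons.prems True in \<open>auto intro: Cons.prems(1)[of "y # B" for B]\<close>)
    next
      case F: False
      then have j: "j = 0"
        using Cons.prems True by auto
      then obtain z C where "L = z # C"
        using Cons.prems True by (cases L) auto
      moreover from this have "\<not> P z"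
        using F j by auto
      ultimately show ?thesis
        using Cons.prems(1)[of "[]" y z C] True j by auto
    qed
  next
    case False
    then obtain j' where j': "j = Suc j'" "j' \<in># gaps P L"
      using Cons.prems by auto
    show ?thesis
      by (rule Cons.IH[OF _ j'(2)]) (use Cons.prems False j' in \<open>auto intro: Cons.prems(1)[of "y # B" for B]\<close>)
  qed
qed simp

lemma wsum_append: "wsum a v t (B @ C) = wsum a v t B + wsum a v (t + length B) C"
  by (induction B arbitrary: t) simp_all

lemma wsum_eq_sum_nth: "wsum a v t L = (\<Sum>s<length L. a (L ! s) * v (t + s))"
  by (induction L arbitrary: t) (simp_all add: sum.lessThan_Suc_shift del: sum.lessThan_Suc)

text \<open>With both internal orders fixed, \<open>gaps\<close> is a bijection onto the boxed
  multisets. Transported along it, the weighted sum satisfies the step condition of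
  \<open>level_set_bound\<close>.\<close>

lemma interleavings_bound:
  assumes p: "prime p" and len: "length L1 + length L2 = p" and ne: "L1 \<noteq> []" "L2 \<noteq> []"
    and P: "\<forall>y\<in>set L1. P y" "\<forall>z\<in>set L2. \<not> P z"
    and a: "\<And>y z. y \<in> set L1 \<Longrightarrow> z \<in> set L2 \<Longrightarrow> a z < a y"
    and v: "\<And>t. Suc t < p \<Longrightarrow> v t < v (Suc t)"
  shows "card {L. filter P L = L1 \<and> filter (Not \<circ> P) L = L2 \<and> wsum a v 0 L = c} * p
    \<le> p choose length L1"
proof -
  define S where "S = {L. filter P L = L1 \<and> filter (Not \<circ> P) L = L2}"
  let ?B = "boxed_multisets (length L1) (length L2)"
  have inj: "inj_on (gaps P) S"
    by (rule inj_onI) (auto simp: S_def intro: gaps_inj[of P])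
  have im: "gaps P ` S = ?B"
    using gaps_surj[OF P] gaps_in_boxed[of P] by (fastforce simp: S_def)
  define G where "G M = wsum a v 0 (inv_into S (gaps P) M)" for M
  have G: "G (gaps P L) = wsum a v 0 L" if "L \<in> S" for L
    using that inj by (simp add: G_def)
  have "card {L. filter P L = L1 \<and> filter (Not \<circ> P) L = L2 \<and> wsum a v 0 L = c}
      = card (gaps P ` {L \<in> S. wsum a v 0 L = c})"
    by (subst card_image) (auto simp: S_def intro: inj_on_subset[OF inj[unfolded S_def]])
  also have "\<dots> \<le> card {M \<in> ?B. G M = c}"
    using im G by (intro card_mono) auto
  also have "\<dots> * p \<le> p choose length L1"
  proof (rule level_set_bound[OF p len])
    fix N j assume N: "size N + 1 = length L1" "set_mset N \<subseteq> {..length L2}" and j: "j < length L2"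
    have "add_mset j N \<in> ?B"
      using N j by (auto simp: boxed_multisets_def)
    then obtain L where L: "L \<in> S" "gaps P L = add_mset j N"
      using im by (metis imageE)
    obtain B y z C where split: "L = B @ y # z # C" "P y" "\<not> P z" "length (filter (Not \<circ> P) B) = j"
    proof (rule gaps_split[of j P L])
      show "j \<in># gaps P L" "j < length (filter (Not \<circ> P) L)"
        using L j by (auto simp: S_def)
    qed
    define L' where "L' = B @ z # y # C"
    have L': "L' \<in> S"
      using L(1) split by (auto simp: S_def L'_def)
    \<comment> \<open>One gap \<open>j\<close> becomes \<open>j + 1\<close>; an element is added on
      both sides so that no multiset subtraction is needed.\<close>
    have "add_mset (Suc j) (gaps P L) = add_mset j (gaps P L')"
      using split by (simp add: L'_def gaps_append multiset.map_comp o_def)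
    then have g: "gaps P L' = add_mset (Suc j) N"
      by (simp add: L(2))
    have "length L = p"
      using L(1) len sum_length_filter_compl[of P L] by (simp add: S_def o_def)
    then have "v (length B) < v (Suc (length B))"
      using split by (intro v) simp
    moreover have "a z < a y"
      using L(1) split by (intro a) (auto simp: S_def)
    \<comment> \<open>The exchange moves the heavier entry \<open>y\<close> to the larger value; the
      gain is this product.\<close>
    ultimately have "0 < (a y - a z) * (v (Suc (length B)) - v (length B))"
      by simp
    also have "\<dots> = wsum a v 0 L' - wsum a v 0 L"
      by (simp add: split L'_def wsum_append algebra_simps)
    finally show "G (add_mset j N) < G (add_mset (Suc j) N)"
      using G[OF L(1)] G[OF L'] by (simp add: g L(2))
  qed (use ne in auto)
  finally show ?thesis
    by simp
qed

section \<open>From interleavings to permutations and bijections\<close>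

text \<open>A permutation of \<open>I\<close> interleaves an order of the positions where
  \<open>a\<close> is maximal with an order of the others. With \<open>m\<close> and
  \<open>k\<close> such positions, summing \<open>(p choose m) / p\<close> over the
  \<open>m! k!\<close> pairs of orders gives \<open>p! / p\<close>.\<close>

lemma permutations_bound:
  assumes p: "prime p" and I: "card I = p" and a: "i \<in> I" "j \<in> I" "a i \<noteq> a j"
    and v: "\<And>t. Suc t < p \<Longrightarrow> v t < v (Suc t)"
  shows "card {L \<in> permutations_of_set I. wsum a v 0 L = c} * p \<le> fact p"
proof -
  have fin: "finite I"
    using I p by (metis card.infinite not_prime_0)
  define x where "x = Max (a ` I)"
  have le: "a y \<le> x" if "y \<in> I" for y
    using that fin by (simp add: x_def)
  have "x \<in> a ` I"
    unfolding x_def using fin a by (intro Max_in) auto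
  define P where "P y \<longleftrightarrow> a y = x" for y
  define I1 where "I1 = {y \<in> I. P y}"
  define I2 where "I2 = {y \<in> I. \<not> P y}"
  have "I = I1 \<union> I2" "I1 \<inter> I2 = {}"
    by (auto simp: I1_def I2_def)
  then have card: "card I1 + card I2 = p"
    using I fin card_Un_disjoint[of I1 I2] by (metis finite_Un)
  have ne: "I1 \<noteq> {}" "I2 \<noteq> {}"
  proof -
    show "I1 \<noteq> {}"
      using \<open>x \<in> a ` I\<close> by (auto simp: I1_def P_def)
    have "a i \<noteq> x \<or> a j \<noteq> x"
      using a by auto
    then show "I2 \<noteq> {}"
      using a by (auto simp: I2_def P_def)
  qed
  have fin12: "finite I1" "finite I2"
    using fin by (auto simp: I1_def I2_def)
  define T where "T = permutations_of_set I1 \<times> permutations_of_set I2"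
  define S where "S = (\<lambda>(L1, L2). {L. filter P L = L1 \<and> filter (Not \<circ> P) L = L2 \<and> wsum a v 0 L = c})"
  have finS: "finite (S K)" for K
  proof (rule finite_subset)
    show "S K \<subseteq> {L. set L \<subseteq> set (fst K) \<union> set (snd K) \<and> length L = length (fst K) + length (snd K)}"
      using sum_length_filter_compl[of P] by (auto simp: S_def o_def)
  qed (simp add: finite_lists_length_eq)
  have "{L \<in> permutations_of_set I. wsum a v 0 L = c} \<subseteq> (\<Union>K\<in>T. S K)"
    by (auto simp: T_def S_def I1_def I2_def permutations_of_set_def)
  then have "card {L \<in> permutations_of_set I. wsum a v 0 L = c} \<le> card (\<Union>K\<in>T. S K)"
    using finS by (intro card_mono) (auto simp: T_def)
  also have "\<dots> \<le> (\<Sum>K\<in>T. card (S K))"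
    by (rule card_UN_le) (simp add: T_def)
  finally have "card {L \<in> permutations_of_set I. wsum a v 0 L = c} * p \<le> (\<Sum>K\<in>T. card (S K) * p)"
    by (simp flip: sum_distrib_right)
  also have "\<dots> \<le> (\<Sum>K\<in>T. p choose card I1)"
  proof (rule sum_mono)
    fix K assume "K \<in> T"
    then obtain L1 L2 where K: "K = (L1, L2)" "set L1 = I1" "distinct L1" "set L2 = I2" "distinct L2"
      by (auto simp: T_def permutations_of_set_def)
    then have len: "length L1 = card I1" "length L2 = card I2"
      by (auto simp: distinct_card)
    have "card {L. filter P L = L1 \<and> filter (Not \<circ> P) L = L2 \<and> wsum a v 0 L = c} * p
        \<le> p choose length L1"
    proof (rule interleavings_bound[OF p])
      show "length L1 + length L2 = p"
        by (simp add: len card)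
      show "L1 \<noteq> []" "L2 \<noteq> []"
        using K ne by auto
      show "\<forall>y\<in>set L1. P y" "\<forall>z\<in>set L2. \<not> P z"
        unfolding K by (auto simp: I1_def I2_def)
      show "a z < a y" if "y \<in> set L1" "z \<in> set L2" for y z
        using that le[of z] unfolding K by (auto simp: I1_def I2_def P_def)
    qed (rule v)
    then show "card (S K) * p \<le> p choose card I1"
      by (simp add: S_def K(1) len)
  qed
  also have "\<dots> = fact (card I1) * fact (card I2) * (p choose card I1)"
    using fin12 by (simp add: T_def card_cartesian_product)
  also have "\<dots> = fact p"
  proof -
    have "card I1 \<le> p" "p - card I1 = card I2"
      using card by simp_all
    then show ?thesis
      using binomial_fact_lemma[of "card I1" p] by simp
  qed
  finally show ?thesis .
qed

text \<open>List the positions by increasing value of \<open>y\<close>: the linear form becomes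
  \<open>wsum\<close> with the sorted elements of \<open>J\<close> as values.\<close>

lemma bijections_bound:
  fixes a :: "'a \<Rightarrow> real" and J :: "real set"
  assumes p: "prime p" and I: "card I = p" and J: "card J = p"
    and a: "i \<in> I" "j \<in> I" "a i \<noteq> a j"
  shows "card {y \<in> extensional I. bij_betw y I J \<and> (\<Sum>i\<in>I. a i * y i) = c} * p \<le> fact p"
proof -
  let ?Y = "{y \<in> extensional I. bij_betw y I J \<and> (\<Sum>i\<in>I. a i * y i) = c}"
  have fin: "finite J"
    using J p by (metis card.infinite not_prime_0)
  define js where "js = sorted_list_of_set J"
  have js: "set js = J" "distinct js" "length js = p"
    using fin J by (auto simp: js_def)
  define F where "F y = map (inv_into I y) js" for y
  have "inj_on F ?Y"
  proof (rule inj_onI)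
    fix y y' assume y: "y \<in> ?Y" and y': "y' \<in> ?Y" and "F y = F y'"
    then have eq: "inv_into I y s = inv_into I y' s" if "s \<in> J" for s
      using that js by (auto simp: F_def)
    show "y = y'"
    proof (rule extensionalityI[of _ I])
      fix i assume "i \<in> I"
      then have "y' i \<in> J" "inv_into I y' (y' i) = i"
        using y' by (auto simp: bij_betw_def)
      then have "inv_into I y (y' i) = i"
        using eq by simp
      then show "y i = y' i"
        using y \<open>y' i \<in> J\<close> by (metis (no_types, lifting) bij_betw_inv_into_right mem_Collect_eq)
    qed (use y y' in auto)
  qed
  moreover have "F ` ?Y \<subseteq> {L \<in> permutations_of_set I. wsum a ((!) js) 0 L = c}"
  proof clarify
    fix y assume y: "bij_betw y I J" and c: "c = (\<Sum>i\<in>I. a i * y i)"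
    have inv: "bij_betw (inv_into I y) J I"
      using y by (rule bij_betw_inv_into)
    have "wsum a ((!) js) 0 (F y) = (\<Sum>t<length js. a (inv_into I y (js ! t)) * js ! t)"
      by (simp add: wsum_eq_sum_nth F_def)
    also have "\<dots> = (\<Sum>s\<in>J. a (inv_into I y s) * s)"
      using js by (intro sum.reindex_bij_betw) (metis bij_betw_nth)
    also have "\<dots> = (\<Sum>i\<in>I. a i * y i)"
      using y by (intro sum.reindex_bij_betw[symmetric, OF y, THEN trans] sum.cong)
        (auto simp: bij_betw_def)
    finally show "F y \<in> permutations_of_set I \<and> wsum a ((!) js) 0 (F y) = (\<Sum>i\<in>I. a i * y i)"
      using inv js by (auto simp: F_def permutations_of_set_def distinct_map bij_betw_def)
  qed
  ultimately have "card ?Y \<le> card {L \<in> permutations_of_set I. wsum a ((!) js) 0 L = c}"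
    by (rule card_inj_on_le) simp
  moreover have "card {L \<in> permutations_of_set I. wsum a ((!) js) 0 L = c} * p \<le> fact p"
  proof (rule permutations_bound[OF p I a])
    fix t assume "Suc t < p"
    then show "js ! t < js ! Suc t"
      using js strict_sorted_list_of_set[of J] unfolding js_def
      by (metis lessI sorted_wrt_nth_less)
  qed
  ultimately show ?thesis
    by (meson mult_le_mono1 order.trans)
qed

section \<open>Orbits and hyperplanes\<close>

lemma card_eq_sum_fibres:
  assumes "finite A"
  shows "card A = (\<Sum>r\<in>g ` A. card {x \<in> A. g x = r})"
  using sum.image_gen[OF assms, of "\<lambda>_. 1 :: nat" g] by simp

text \<open>Viewing orbit points as bijective fillings with a fixed value set allows them to be
  split into a frozen part and a bijection on the remaining positions.\<close>

lemma perm_orbit_eq: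
  fixes v :: "real^'n"
  assumes "inj (($) v)"
  shows "perm_orbit v = {y. bij_betw (($) y) UNIV (range (($) v))}"
proof (intro equalityI subsetI)
  fix y :: "real^'n" assume "y \<in> perm_orbit v"
  then obtain \<sigma> where \<sigma>: "\<sigma> permutes UNIV" "y = (\<chi> i. v $ \<sigma> i)"
    by (auto simp: perm_orbit_def)
  have "bij_betw (($) v \<circ> \<sigma>) UNIV (range (($) v))"
    using permutes_imp_bij[OF \<sigma>(1)] inj_on_imp_bij_betw[OF assms] by (rule bij_betw_trans)
  then show "y \<in> {y. bij_betw (($) y) UNIV (range (($) v))}"
    by (simp add: \<sigma>(2) o_def cong: bij_betw_cong)
next
  fix y :: "real^'n" assume "y \<in> {y. bij_betw (($) y) UNIV (range (($) v))}"
  then have y: "bij_betw (($) y) UNIV (range (($) v))" by simp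
  define \<sigma> where "\<sigma> = inv_into UNIV (($) v) \<circ> ($) y"
  have "bij_betw \<sigma> UNIV UNIV"
    unfolding \<sigma>_def using y bij_betw_inv_into[OF inj_on_imp_bij_betw[OF assms]]
    by (rule bij_betw_trans)
  then have "\<sigma> permutes UNIV"
    by (rule bij_imp_permutes) simp
  moreover have "v $ \<sigma> i = y $ i" for i
    using y by (simp add: \<sigma>_def f_inv_into_f bij_betw_apply)
  ultimately show "y \<in> perm_orbit v"
    unfolding perm_orbit_def by (auto simp: vec_eq_iff intro!: exI[of _ \<sigma>])
qed

lemma inj_on_perm_orbit_map:
  fixes v :: "real^'n"
  assumes "inj (($) v)"
  shows "inj (\<lambda>\<sigma> :: 'n \<Rightarrow> 'n. \<chi> i. v $ \<sigma> i)"
proof (rule injI)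
  fix \<sigma> \<tau> :: "'n \<Rightarrow> 'n" assume "(\<chi> i. v $ \<sigma> i) = (\<chi> i. v $ \<tau> i)"
  then show "\<sigma> = \<tau>"
    using assms by (auto simp: vec_eq_iff inj_def)
qed

lemma perm_orbit_image: "perm_orbit v = (\<lambda>\<sigma>. \<chi> i. v $ \<sigma> i) ` {\<sigma>. \<sigma> permutes UNIV}"
  by (auto simp: perm_orbit_def)

lemma finite_perm_orbit [simp]: "finite (perm_orbit (v :: real^'n::finite))"
  by (simp add: perm_orbit_image)

lemma sum_perm_orbit:
  fixes v :: "real^'n::finite"
  assumes "y \<in> perm_orbit v"
  shows "(\<Sum>i\<in>UNIV. y $ i) = (\<Sum>i\<in>UNIV. v $ i)"
proof -
  obtain \<sigma> where "\<sigma> permutes UNIV" and y: "y = (\<chi> i. v $ \<sigma> i)"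
    using assms by (auto simp: perm_orbit_def)
  then show ?thesis
    using sum.permute[of \<sigma> UNIV "($) v"] by (simp add: o_def)
qed

lemma hyperplane_orbit_bound:
  fixes v :: "real^'n::finite"
  assumes p: "prime p" "p \<le> CARD('n)" and v: "admissible v" and H: "lin_hyperplane H"
  shows "card (H \<inter> perm_orbit v) * p \<le> fact (CARD('n))"
proof -
  obtain a where a0: "a \<noteq> 0" and Ha: "H = {x. a \<bullet> x = 0}"
    using H by (auto simp: lin_hyperplane_def)
  have inj: "inj (($) v)"
    using v by (simp add: admissible_def)
  show ?thesis
  proof (cases "\<exists>i j. a $ i \<noteq> a $ j")
    case False
    then obtain t where t: "\<And>i. a $ i = t"
      by metis
    then have "t \<noteq> 0"
      using a0 by (auto simp: vec_eq_iff)
    have "a \<bullet> y = t * (\<Sum>i\<in>UNIV. v $ i)" if "y \<in> perm_orbit v" for y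
      using sum_perm_orbit[OF that] by (simp add: inner_vec_def t flip: sum_distrib_left)
    then have "H \<inter> perm_orbit v = {}"
      using v \<open>t \<noteq> 0\<close> by (auto simp: Ha admissible_def)
    then show ?thesis by simp
  next
    case True
    then obtain i j where ij: "a $ i \<noteq> a $ j" by blast
    have "\<exists>I. {i, j} \<subseteq> I \<and> I \<subseteq> UNIV \<and> card I = p"
      using p ij prime_ge_2_nat[OF p(1)] by (intro exists_subset_between) (auto simp: card_insert_if)
    then obtain I where I: "i \<in> I" "j \<in> I" "card I = p"
      by auto
    define V where "V = range (($) v)"
    define E where "E = perm_orbit v"
    define rho where "rho y = restrict (($) y) (- I)" for y :: "real^'n"
    have E: "y \<in> E \<longleftrightarrow> bij_betw (($) y) UNIV V" for y
      by (simp add: E_def V_def perm_orbit_eq[OF inj])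
    have cardV: "card V = CARD('n)"
      unfolding V_def using inj by (rule card_image)
    \<comment> \<open>Among the orbit points with the same frozen coordinates at most
      \<open>p! / p\<close> lie in \<open>H\<close>, while there are at least \<open>p!\<close> of
      them.\<close>
    have fibre: "card {y \<in> H \<inter> E. rho y = r} * p \<le> card {y \<in> E. rho y = r}" if r: "r \<in> rho ` E" for r
    proof -
      obtain y0 where y0: "y0 \<in> E" "rho y0 = r"
        using r by blast
      define J where "J = V - r ` (- I)"
      have r_eq: "r ` (- I) = ($) y ` (- I)" if "rho y = r" for y
        using that by (auto simp: rho_def)
      have bij: "bij_betw (($) y) I J" if "y \<in> E" "rho y = r" for y
      proof -
        have "bij_betw (($) y) (UNIV - (- I)) (V - ($) y ` (- I))"
          using that(1) by (intro bij_betw_DiffI) (auto simp: E bij_betw_def inj_on_def)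
        then show ?thesis
          by (simp add: J_def r_eq[OF that(2)] Diff_eq)
      qed
      have J: "card J = p"
        using bij_betw_same_card[OF bij[OF y0]] I by simp
      define c where "c = - (\<Sum>i\<in>- I. a $ i * r i)"
      let ?Y = "{f \<in> extensional I. bij_betw f I J \<and> (\<Sum>i\<in>I. a $ i * f i) = c}"
      have "card {y \<in> H \<inter> E. rho y = r} \<le> card ?Y"
      proof (rule card_inj_on_le[of "\<lambda>y. restrict (($) y) I"])
        show "inj_on (\<lambda>y. restrict (($) y) I) {y \<in> H \<inter> E. rho y = r}"
        proof (rule inj_onI)
          fix y y' assume *: "y \<in> {y \<in> H \<inter> E. rho y = r}" "y' \<in> {y \<in> H \<inter> E. rho y = r}"
            "restrict (($) y) I = restrict (($) y') I"
          have "y $ i = y' $ i" for i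
          proof (cases "i \<in> I")
            case True
            then show ?thesis
              using fun_cong[OF *(3), of i] by simp
          next
            case False
            have "rho y i = rho y' i" using * by simp
            then show ?thesis
              using False by (simp add: rho_def)
          qed
          then show "y = y'" by (simp add: vec_eq_iff)
        qed
        show "(\<lambda>y. restrict (($) y) I) ` {y \<in> H \<inter> E. rho y = r} \<subseteq> ?Y"
        proof clarify
          fix y assume y: "y \<in> H" "y \<in> E" "r = rho y"
          have "(\<Sum>i\<in>UNIV. a $ i * y $ i) = (\<Sum>i\<in>I. a $ i * y $ i) + (\<Sum>i\<in>- I. a $ i * y $ i)"
            by (subst sum.union_disjoint[symmetric]) auto
          moreover have "(\<Sum>i\<in>UNIV. a $ i * y $ i) = 0"
            using y(1) by (simp add: Ha inner_vec_def)
          moreover have "(\<Sum>i\<in>- I. a $ i * y $ i) = - c"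
            by (simp add: c_def y(3) rho_def)
          ultimately show "restrict (($) y) I \<in> extensional I \<and> bij_betw (restrict (($) y) I) I J
              \<and> (\<Sum>i\<in>I. a $ i * restrict (($) y) I i) = c"
            using bij[of y] y by (simp cong: bij_betw_cong)
        qed
        have "finite J" using J p(1) by (metis card.infinite not_prime_0)
        then show "finite ?Y"
          by (intro finite_subset[of ?Y "I \<rightarrow>\<^sub>E J"] finite_PiE)
            (auto simp: PiE_def bij_betw_def)
      qed
      then have "card {y \<in> H \<inter> E. rho y = r} * p \<le> card ?Y * p"
        by simp
      also have "\<dots> \<le> fact p"
        using ij by (intro bijections_bound[OF p(1) I(3) J I(1,2)])
      also have "\<dots> = card {\<sigma>. \<sigma> permutes I}"
        using I by (subst card_permutations[where n = p]) auto
      \<comment> \<open>Permuting the coordinates of \<open>y0\<close> inside \<open>I\<close> stays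
        in the fibre.\<close>
      also have "\<dots> \<le> card {y \<in> E. rho y = r}"
      proof (rule card_inj_on_le[of "\<lambda>\<sigma>. \<chi> i. y0 $ \<sigma> i"])
        show "inj_on (\<lambda>\<sigma>. \<chi> i. y0 $ \<sigma> i) {\<sigma>. \<sigma> permutes I}"
          using y0(1) by (intro inj_on_subset[OF inj_on_perm_orbit_map]) (auto simp: E bij_betw_def)
        show "(\<lambda>\<sigma>. \<chi> i. y0 $ \<sigma> i) ` {\<sigma>. \<sigma> permutes I} \<subseteq> {y \<in> E. rho y = r}"
        proof clarify
          fix \<sigma> assume \<sigma>: "\<sigma> permutes I"
          have "bij_betw (($) y0 \<circ> \<sigma>) UNIV V"
            using permutes_bij[OF \<sigma>] y0(1) by (auto simp: E intro: bij_betw_trans)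
          moreover have "rho (\<chi> i. y0 $ \<sigma> i) = rho y0"
            using permutes_not_in[OF \<sigma>] by (auto simp: rho_def)
          ultimately show "(\<chi> i. y0 $ \<sigma> i) \<in> E \<and> rho (\<chi> i. y0 $ \<sigma> i) = r"
            using y0 by (simp add: E o_def cong: bij_betw_cong)
        qed
      qed (simp add: E_def)
      finally show ?thesis .
    qed
    have fin: "finite E" by (simp add: E_def)
    have "card (H \<inter> E) * p = (\<Sum>r\<in>rho ` (H \<inter> E). card {y \<in> H \<inter> E. rho y = r} * p)"
      using card_eq_sum_fibres[of "H \<inter> E" rho] fin by (simp flip: sum_distrib_right)
    also have "\<dots> \<le> (\<Sum>r\<in>rho ` (H \<inter> E). card {y \<in> E. rho y = r})"
      using fibre by (intro sum_mono) blast
    also have "\<dots> \<le> (\<Sum>r\<in>rho ` E. card {y \<in> E. rho y = r})"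
      using fin by (intro sum_mono2) auto
    also have "\<dots> = card E"
      using card_eq_sum_fibres[OF fin, of rho] by simp
    also have "\<dots> \<le> card {\<sigma>. \<sigma> permutes (UNIV :: 'n set)}"
      unfolding E_def perm_orbit_image by (rule card_image_le) simp
    also have "\<dots> = fact (CARD('n))"
      by (rule card_permutations) auto
    finally show ?thesis
      by (simp add: E_def)
  qed
qed

section \<open>Extremal examples\<close>

lemma admissible_enumeration:
  fixes h :: "'n::finite \<Rightarrow> nat"
  assumes h: "bij_betw h UNIV {0..<CARD('n)}" and n: "CARD('n) \<ge> 2"
  shows "admissible (\<chi> i. real (h i))"
    and "(\<Sum>i\<in>UNIV. real (h i)) = real (CARD('n)) * (real (CARD('n)) - 1) / 2"
proof -
  have gauss: "(\<Sum>t = 0..<n. real t) = real n * (real n - 1) / 2" for n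
    by (induction n) (simp_all add: field_simps)
  have "(\<Sum>i\<in>UNIV. real (h i)) = (\<Sum>t = 0..<CARD('n). real t)"
    by (rule sum.reindex_bij_betw[OF h])
  also have "\<dots> = real (CARD('n)) * (real (CARD('n)) - 1) / 2"
    using gauss[of "CARD('n)"] .
  finally show s: "(\<Sum>i\<in>UNIV. real (h i)) = real (CARD('n)) * (real (CARD('n)) - 1) / 2" .
  show "admissible (\<chi> i. real (h i))"
    using h n s by (auto simp: admissible_def bij_betw_def inj_def)
qed

lemma exists_permutation_two_points:
  assumes "i1 \<noteq> i2" "x \<noteq> y"
  shows "\<exists>\<tau>. \<tau> permutes UNIV \<and> \<tau> i1 = x \<and> \<tau> i2 = y"
proof -
  define \<tau>' where "\<tau>' = Transposition.transpose i1 x"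
  have "\<tau>' i2 \<noteq> x"
    using assms(1) unfolding \<tau>'_def by (metis transpose_eq_iff)
  then have "(Transposition.transpose (\<tau>' i2) y \<circ> \<tau>') i1 = x" "(Transposition.transpose (\<tau>' i2) y \<circ> \<tau>') i2 = y"
    using assms by (auto simp: \<tau>'_def transpose_def)
  moreover have "Transposition.transpose (\<tau>' i2) y \<circ> \<tau>' permutes UNIV"
    unfolding \<tau>'_def by (intro permutes_compose permutes_swap_id) auto
  ultimately show ?thesis by blast
qed

text \<open>The coordinate hyperplane at the position of the entry 0 contains the images under all
  permutations fixing that position.\<close>

lemma coordinate_hyperplane_witness:
  assumes n: "CARD('n::finite) \<ge> 2"
  shows "\<exists>(v::real^'n) H. admissible v \<and> lin_hyperplane H \<and>
    fact (CARD('n) - 1) \<le> card (H \<inter> perm_orbit v)"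
proof -
  obtain h :: "'n \<Rightarrow> nat" where h: "bij_betw h UNIV {0..<CARD('n)}"
    using ex_bij_betw_finite_nat[of "UNIV :: 'n set"] by auto
  define v :: "real^'n" where "v = (\<chi> i. real (h i))"
  have adm: "admissible v"
    unfolding v_def by (rule admissible_enumeration[OF h n])
  have "0 \<in> h ` UNIV"
    using h n by (auto simp: bij_betw_def)
  then obtain i0 where i0: "h i0 = 0"
    by (metis imageE)
  define H where "H = {x :: real^'n. axis i0 1 \<bullet> x = 0}"
  have "lin_hyperplane H"
    unfolding H_def lin_hyperplane_def by (intro exI[of _ "axis i0 1"]) simp
  moreover have "card {\<sigma>. \<sigma> permutes (UNIV - {i0})} \<le> card (H \<inter> perm_orbit v)"
  proof (rule card_inj_on_le[of "\<lambda>\<sigma>. \<chi> i. v $ \<sigma> i"])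
    show "inj_on (\<lambda>\<sigma>. \<chi> i. v $ \<sigma> i) {\<sigma>. \<sigma> permutes (UNIV - {i0})}"
      using adm by (intro inj_on_subset[OF inj_on_perm_orbit_map]) (auto simp: admissible_def)
    show "(\<lambda>\<sigma>. \<chi> i. v $ \<sigma> i) ` {\<sigma>. \<sigma> permutes (UNIV - {i0})} \<subseteq> H \<inter> perm_orbit v"
      using i0 by (auto simp: H_def inner_axis' perm_orbit_def v_def permutes_not_in
          intro: permutes_subset)
  qed simp
  moreover have "card {\<sigma>. \<sigma> permutes (UNIV - {i0})} = fact (CARD('n) - 1)"
    by (rule card_permutations) (simp_all add: card_Diff_subset)
  ultimately show ?thesis
    using adm by metis
qed

text \<open>Require two coordinates to sum to \<open>n - 1\<close>: there are \<open>n\<close>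
  ordered pairs \<open>(u, n - 1 - u)\<close>, and the other entries can be arranged in
  \<open>(n - 2)!\<close> ways.\<close>

lemma pair_sum_hyperplane_witness:
  assumes n: "CARD('n::finite) \<ge> 3" and even: "even (CARD('n))"
  shows "\<exists>(v::real^'n) H. admissible v \<and> lin_hyperplane H \<and>
    CARD('n) * fact (CARD('n) - 2) \<le> card (H \<inter> perm_orbit v)"
proof -
  obtain h :: "'n \<Rightarrow> nat" where h: "bij_betw h UNIV {0..<CARD('n)}"
    using ex_bij_betw_finite_nat[of "UNIV :: 'n set"] by auto
  define v :: "real^'n" where "v = (\<chi> i. real (h i))"
  have adm: "admissible v"
    unfolding v_def using n by (intro admissible_enumeration[OF h]) simp
  have "\<not> is_singleton (UNIV :: 'n set)"
    using n by (auto simp: is_singleton_altdef)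
  then obtain i1 i2 :: 'n where i: "i1 \<noteq> i2"
    by (metis (full_types) is_singletonI' empty_not_UNIV)
  \<comment> \<open>The entries of \<open>v\<close> fall into pairs of sum \<open>n - 1\<close>; as the entries of every \<open>y\<close> in the orbit have sum
    \<open>n (n - 1) / 2\<close>, the affine condition \<open>y i1 + y i2 = n - 1\<close> is the linear one given by \<open>a\<close>.\<close>
  define a :: "real^'n" where
    "a = axis i1 1 + axis i2 1 - (\<chi> i. 2 / real (CARD('n)))"
  define H where "H = {x. a \<bullet> x = 0}"
  \<comment> \<open>This entry is \<open>1 - 2 / n\<close>, nonzero because
    \<open>n \<ge> 3\<close>.\<close>
  have "a $ i1 \<noteq> 0"
    using i n by (simp add: a_def axis_def field_simps)
  then have "lin_hyperplane H"
    unfolding H_def lin_hyperplane_def by (intro exI[of _ a]) auto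
  moreover have inH: "y \<in> H" if "y \<in> perm_orbit v" "y $ i1 + y $ i2 = real (CARD('n)) - 1" for y
  proof -
    have "a \<bullet> y = y $ i1 + y $ i2 - 2 / real (CARD('n)) * (\<Sum>i\<in>UNIV. y $ i)"
      by (simp add: a_def inner_diff_left inner_add_left inner_axis' sum_distrib_left
          inner_vec_def[of "\<chi> i. _"])
    also have "(\<Sum>i\<in>UNIV. y $ i) = real (CARD('n)) * (real (CARD('n)) - 1) / 2"
      using admissible_enumeration(2)[OF h] n sum_perm_orbit[OF that(1)] by (simp add: v_def)
    finally show ?thesis
      using n that(2) by (simp add: H_def field_simps)
  qed
  have "\<exists>\<tau>. \<tau> permutes UNIV \<and> h (\<tau> i1) = u \<and> h (\<tau> i2) = CARD('n) - 1 - u"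
    if u: "u \<in> {0..<CARD('n)}" for u
  proof -
    have "CARD('n) - 1 - u \<in> {0..<CARD('n)}"
      using n by auto
    then obtain x y where xy: "h x = u" "h y = CARD('n) - 1 - u"
      using u h by (metis bij_betw_def imageE)
    \<comment> \<open>As \<open>n\<close> is even, \<open>n - 1\<close> is odd, so no entry is
      paired with itself.\<close>
    have "u \<noteq> CARD('n) - 1 - u"
      using even n u by (auto; presburger)
    then have "x \<noteq> y"
      using xy by auto
    then show ?thesis
      using exists_permutation_two_points[OF i] xy by metis
  qed
  then obtain \<tau> where \<tau>: "\<And>u. u \<in> {0..<CARD('n)} \<Longrightarrow>
      \<tau> u permutes UNIV \<and> h (\<tau> u i1) = u \<and> h (\<tau> u i2) = CARD('n) - 1 - u"
    by metis
  \<comment> \<open>\<open>\<tau> u\<close> places the pair at \<open>i1\<close> and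
    \<open>i2\<close>, and \<open>\<rho>\<close> rearranges the remaining positions.\<close>
  define F :: "nat \<times> ('n \<Rightarrow> 'n) \<Rightarrow> real^'n"
    where "F = (\<lambda>(u, \<rho>). \<chi> i. v $ (\<tau> u \<circ> \<rho>) i)"
  let ?D = "{0..<CARD('n)} \<times> {\<rho>. \<rho> permutes (UNIV - {i1, i2})}"
  have fix12: "\<rho> i1 = i1" "\<rho> i2 = i2" if "\<rho> permutes (UNIV - {i1, i2})" for \<rho>
    using permutes_not_in[OF that] by auto
  have "card ?D \<le> card (H \<inter> perm_orbit v)"
  proof (rule card_inj_on_le[of F])
    show "inj_on F ?D"
    proof (rule inj_onI, clarify)
      fix u \<rho> u' \<rho>' assume u: "u \<in> {0..<CARD('n)}" "u' \<in> {0..<CARD('n)}"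
        and \<rho>: "\<rho> permutes (UNIV - {i1, i2})" "\<rho>' permutes (UNIV - {i1, i2})"
        and eq: "F (u, \<rho>) = F (u', \<rho>')"
      have "inj (($) v)"
        using adm by (simp add: admissible_def)
      then have comp: "\<tau> u \<circ> \<rho> = \<tau> u' \<circ> \<rho>'"
      proof (rule injD[OF inj_on_perm_orbit_map])
        show "(\<chi> i. v $ (\<tau> u \<circ> \<rho>) i) = (\<chi> i. v $ (\<tau> u' \<circ> \<rho>') i)"
          using eq by (simp only: F_def prod.case)
      qed
      \<comment> \<open>The entry at \<open>i1\<close> reveals \<open>u\<close>; then
        \<open>\<tau> u\<close> can be cancelled to recover \<open>\<rho>\<close>.\<close>
      have "\<tau> u i1 = \<tau> u' i1"
        using fun_cong[OF comp, of i1] by (simp only: o_apply fix12[OF \<rho>(1)] fix12[OF \<rho>(2)])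
      then have "u = u'"
        using \<tau>[OF u(1)] \<tau>[OF u(2)] by argo
      moreover have "inj (\<tau> u)"
        using \<tau>[OF u(1)] by (blast intro: permutes_inj)
      then have "\<rho> = \<rho>'" if "u = u'"
        using comp that by (auto simp: fun_eq_iff dest: injD)
      ultimately show "u = u' \<and> \<rho> = \<rho>'"
        by blast
    qed
    show "F ` ?D \<subseteq> H \<inter> perm_orbit v"
    proof clarify
      fix u \<rho> assume u: "u \<in> {0..<CARD('n)}" and \<rho>: "\<rho> permutes (UNIV - {i1, i2})"
      have "\<tau> u \<circ> \<rho> permutes UNIV"
        using \<tau>[OF u] \<rho> by (auto intro: permutes_compose permutes_subset)
      then have orb: "F (u, \<rho>) \<in> perm_orbit v"
        by (auto simp: perm_orbit_image F_def intro: image_eqI[of _ _ "\<tau> u \<circ> \<rho>"])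
      moreover have "F (u, \<rho>) $ i1 + F (u, \<rho>) $ i2 = real (CARD('n)) - 1"
        using \<tau>[OF u] fix12[OF \<rho>] u by (simp add: F_def v_def)
      ultimately show "F (u, \<rho>) \<in> H \<inter> perm_orbit v"
        using inH by blast
    qed
  qed simp
  moreover have "card {\<rho>. \<rho> permutes (UNIV - {i1, i2})} = fact (CARD('n) - 2)"
    using i by (intro card_permutations) (simp_all add: card_Diff_subset)
  ultimately show ?thesis
    using adm by (intro exI[of _ v] exI[of _ H]) (simp add: card_cartesian_product)
qed

theorem theorem1p5:
  fixes p :: nat
  assumes n2: "CARD('n::finite) \<ge> 2"
    and pprime: "prime p" and ple: "p \<le> CARD('n)"
    and pmax: "\<forall>q::nat. prime q \<and> q \<le> CARD('n) \<longrightarrow> q \<le> p"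
  shows "(\<forall>(v::real^'n) H. admissible v \<and> lin_hyperplane H \<longrightarrow>
            real (card (H \<inter> perm_orbit v)) \<le> real (fact (CARD('n))) / real p)
       \<and> (CARD('n) \<ge> 3 \<and> (CARD('n) = p \<or> CARD('n) = p + 1) \<longrightarrow>
            (let M = (if odd (CARD('n)) then fact (CARD('n) - 1)
                      else CARD('n) * fact (CARD('n) - 2)) in
              (\<forall>(v::real^'n) H. admissible v \<and> lin_hyperplane H \<longrightarrow>
                  card (H \<inter> perm_orbit v) \<le> M)
            \<and> (\<exists>(v::real^'n) H. admissible v \<and> lin_hyperplane H \<and>
                  card (H \<inter> perm_orbit v) = M)))"
proof (intro conjI impI allI)
  fix v :: "real^'n" and H :: "(real^'n) set"
  assume "admissible v \<and> lin_hyperplane H"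
  then have "card (H \<inter> perm_orbit v) * p \<le> fact (CARD('n))"
    using hyperplane_orbit_bound[OF pprime ple] by blast
  then have "real (card (H \<inter> perm_orbit v) * p) \<le> real (fact (CARD('n)))"
    by (simp only: of_nat_le_iff)
  then show "real (card (H \<inter> perm_orbit v)) \<le> real (fact (CARD('n))) / real p"
    using prime_gt_0_nat[OF pprime] by (simp add: field_simps)
next
  assume *: "CARD('n) \<ge> 3 \<and> (CARD('n) = p \<or> CARD('n) = p + 1)"
  define M where "M = (if odd (CARD('n)) then fact (CARD('n) - 1)
                      else CARD('n) * fact (CARD('n) - 2))"
  \<comment> \<open>Maximality gives \<open>p \<ge> 3\<close>, so \<open>p\<close> is odd. Hence
    \<open>n = p\<close> for odd \<open>n\<close> and \<open>n = p + 1\<close> for even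
    \<open>n\<close>, and \<open>M = n! / p\<close> in both cases.\<close>
  have "prime (3 :: nat)" by simp
  then have "p \<ge> 3"
    using pmax * by blast
  then have "odd p"
    using pprime prime_odd_nat by auto
  then have fact: "fact (CARD('n)) = M * p"
    using * \<open>p \<ge> 3\<close> by (auto simp: M_def fact_reduce[of "CARD('n)"] fact_reduce[of p] mult_ac)
  have upper: "card (H \<inter> perm_orbit v) \<le> M" if "admissible v" "lin_hyperplane H"
    for v :: "real^'n" and H
    using hyperplane_orbit_bound[OF pprime ple that] \<open>p \<ge> 3\<close> by (simp add: fact)
  \<comment> \<open>The examples need only reach \<open>M\<close>; the upper bound turns this into
    equality.\<close>
  have "\<exists>(v::real^'n) H. admissible v \<and> lin_hyperplane H \<and> M \<le> card (H \<inter> perm_orbit v)"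
    using coordinate_hyperplane_witness[OF n2] pair_sum_hyperplane_witness * by (auto simp: M_def)
  then show "let M = (if odd (CARD('n)) then fact (CARD('n) - 1)
                      else CARD('n) * fact (CARD('n) - 2)) in
              (\<forall>(v::real^'n) H. admissible v \<and> lin_hyperplane H \<longrightarrow>
                  card (H \<inter> perm_orbit v) \<le> M)
            \<and> (\<exists>(v::real^'n) H. admissible v \<and> lin_hyperplane H \<and>
                  card (H \<inter> perm_orbit v) = M)"
    unfolding Let_def M_def[symmetric] using upper by (metis le_antisym)
qed

end
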